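(* For any $N$ that is a multiple of $3$, the graph $\mathcal{H}_N$ is connected.
   Context: Label the points of a convex $N$-gon $1,\ldots,N$ counterclockwise and color them red, blue, green alternatingly (point $i$ is red, blue, or green according as $i\equiv 1,2,0 \pmod 3$). Let $\mathcal{C}'_N$ be the set of triangulations of the convex $N$-gon in which every triangle has one point of each of the three colors. A twist is the following operation: if a triangle of the triangulation has each of its three edges shared with another triangle, then the union of these four triangles is a hexagon with vertices $h_1,\ldots,h_6$ in circular order, triangulated by the inner triangle $h_1h_3h_5$ and the triangles $h_1h_2h_3$, $h_3h_4h_5$, $h_5h_6h_1$; the twist replaces this by the triangulation of the hexagon with inner triangle $h_2h_4h_6$ and triangles $h_2h_3h_4$, $h_4h_5h_6$, $h_6h_1h_2$, leaving the rest unchanged. $\mathcal{H}_N$ is the graph with node set $\mathcal{C}'_N$ and an edge between two triangulations that differ in a twist. *)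

theory Defs
  imports "Graph_Theory.Digraph_Component"
begin

text \<open>
  The convex \<open>N\<close>-gon is represented by its vertex labels \<open>{1..N}\<close> in counterclockwise order, and
  a segment between two vertices by the two-element set of its endpoints.
\<close>

definition segments :: "nat \<Rightarrow> nat set set" where
  "segments N = {{a, b} | a b. a \<in> {1..N} \<and> b \<in> {1..N} \<and> a \<noteq> b}"

definition sides :: "nat \<Rightarrow> nat set set" where
  "sides N = insert {N, 1} {{i, i + 1} | i. 1 \<le> i \<and> i < N}"

definition diagonals :: "nat \<Rightarrow> nat set set" where
  "diagonals N = segments N - sides N"

text \<open>
  Two segments between vertices of a convex polygon meet in their relative interiors (without
  coinciding) iff their endpoints interleave in the circular order.
\<close>

definition crossing :: "nat set \<Rightarrow> nat set \<Rightarrow> bool" where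
  "crossing d e \<longleftrightarrow> (\<exists>a b c d'. a < b \<and> b < c \<and> c < d' \<and>
     (d = {a, c} \<and> e = {b, d'} \<or> d = {b, d'} \<and> e = {a, c}))"

text \<open>A triangulation is a maximal set of pairwise non-crossing diagonals.\<close>

definition triangulation :: "nat \<Rightarrow> nat set set \<Rightarrow> bool" where
  "triangulation N T \<longleftrightarrow> T \<subseteq> diagonals N \<and>
     (\<forall>d\<in>T. \<forall>e\<in>T. \<not> crossing d e) \<and>
     (\<forall>d\<in>diagonals N - T. \<exists>e\<in>T. crossing d e)"

text \<open>
  Since all points are on the boundary of the polygon, three vertices span a triangle of a
  triangulation as soon as they are pairwise joined by sides or by diagonals of the triangulation.
\<close>

definition triangles :: "nat \<Rightarrow> nat set set \<Rightarrow> nat set set" where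
  "triangles N T = {{a, b, c} | a b c. a \<in> {1..N} \<and> b \<in> {1..N} \<and> c \<in> {1..N} \<and>
     a \<noteq> b \<and> b \<noteq> c \<and> a \<noteq> c \<and>
     {a, b} \<in> T \<union> sides N \<and> {b, c} \<in> T \<union> sides N \<and> {a, c} \<in> T \<union> sides N}"

datatype color = Red | Blue | Green

definition color_of :: "nat \<Rightarrow> color" where
  "color_of i = (if i mod 3 = 1 then Red else if i mod 3 = 2 then Blue else Green)"

definition colorful_triangulations :: "nat \<Rightarrow> nat set set set" where
  "colorful_triangulations N =
     {T. triangulation N T \<and> (\<forall>t\<in>triangles N T. color_of ` t = {Red, Blue, Green})}"

definition circular_order :: "nat list \<Rightarrow> bool" where
  "circular_order hs \<longleftrightarrow> (\<exists>k. sorted_wrt (<) (rotate k hs))"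

text \<open>
  The hexagon is labelled counterclockwise. A clockwise labelling, read backwards from
  \<open>h\<^sub>1\<close>, is a counterclockwise one with the same odd-indexed and the same even-indexed vertices,
  so this is no restriction. As a triangulation is the set of its diagonals, retriangulating the
  hexagon means exchanging the three sides of the inner triangle.
\<close>

definition twist :: "nat \<Rightarrow> nat set set \<Rightarrow> nat set set \<Rightarrow> bool" where
  "twist N T T' \<longleftrightarrow> (\<exists>h1 h2 h3 h4 h5 h6. circular_order [h1, h2, h3, h4, h5, h6] \<and>
     {{h1, h3, h5}, {h1, h2, h3}, {h3, h4, h5}, {h5, h6, h1}} \<subseteq> triangles N T \<and>
     T' = (T - {{h1, h3}, {h3, h5}, {h5, h1}}) \<union> {{h2, h4}, {h4, h6}, {h6, h2}})"

text \<open>Undirected edges are represented by pairs of opposite arcs.\<close>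

definition twist_graph :: "nat \<Rightarrow> nat set set pair_pre_digraph" where
  "twist_graph N = \<lparr>pverts = colorful_triangulations N,
     parcs = {(T, T'). T \<in> colorful_triangulations N \<and> T' \<in> colorful_triangulations N \<and>
       (twist N T T' \<or> twist N T' T)}\<rparr>"

end

theory Submission
  imports Defs
begin

text \<open>
  Call three diagonals \<open>{a, a + 2}\<close>, \<open>{a + 2, a + 4}\<close>, \<open>{a, a + 4}\<close> an ear at \<open>a\<close>. In a
  triangle \<open>x < z < y\<close> the colors red, blue, green appear clockwise iff \<open>y - x\<close> is \<open>1\<close> modulo \<open>3\<close>; a
  clockwise triangle of minimal span \<open>y - x\<close> is the middle triangle of an ear, so every colorful
  triangulation with \<open>N \<ge> 6\<close> has an ear. Cutting off the ear at \<open>a\<close> gives a bijection between the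
  colorful triangulations of the \<open>N\<close>-gon with this ear and all colorful triangulations of the
  \<open>(N - 3)\<close>-gon, and twists lift along it. So by induction all triangulations with an ear at \<open>a\<close>
  are connected to each other. Finally, if a triangulation of the \<open>(N - 3)\<close>-gon contains
  \<open>{a, a + 2}\<close>, inserting an ear at \<open>a\<close> or at \<open>a + 1\<close> gives two triangulations that differ by the
  twist of the hexagon \<open>a, \<dots>, a + 5\<close>, which connects the classes of consecutive \<open>a\<close>.
\<close>

section \<open>Triangulations and colors in terms of edges between ordered labels\<close>

definition edge :: "nat \<Rightarrow> nat set set \<Rightarrow> nat \<Rightarrow> nat \<Rightarrow> bool" where
  "edge N T x y \<longleftrightarrow> {x, y} \<in> T \<union> sides N"

lemma edge_commute: "edge N T x y \<longleftrightarrow> edge N T y x"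
  by (simp add: edge_def insert_commute)

lemma crossing_iff:
  assumes "x < y" "u < v"
  shows "crossing {x, y} {u, v} \<longleftrightarrow> x < u \<and> u < y \<and> y < v \<or> u < x \<and> x < v \<and> v < y"
  using assms unfolding crossing_def doubleton_eq_iff by (auto; blast)

lemma segments_iff:
  assumes "x < y"
  shows "{x, y} \<in> segments N \<longleftrightarrow> 1 \<le> x \<and> y \<le> N"
  using assms unfolding segments_def by (force simp: doubleton_eq_iff)

lemma sides_iff:
  assumes "x < y" "3 \<le> N"
  shows "{x, y} \<in> sides N \<longleftrightarrow> 1 \<le> x \<and> y = Suc x \<and> y \<le> N \<or> x = 1 \<and> y = N"
  using assms unfolding sides_def by (auto simp: doubleton_eq_iff)

lemma segments_cases:
  assumes "d \<in> segments N"
  obtains x y where "d = {x, y}" "x < y" "1 \<le> x" "y \<le> N"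
proof -
  obtain a b where "d = {a, b}" "a \<in> {1..N}" "b \<in> {1..N}" "a \<noteq> b"
    using assms unfolding segments_def by blast
  then show thesis
    using that[of a b] that[of b a] by (cases "a < b") (auto simp: insert_commute)
qed

lemma sides_subset_segments: "3 \<le> N \<Longrightarrow> sides N \<subseteq> segments N"
  unfolding sides_def segments_def by (force simp: doubleton_eq_iff)

lemma diagonals_iff:
  assumes "x < y" "3 \<le> N"
  shows "{x, y} \<in> diagonals N \<longleftrightarrow> 1 \<le> x \<and> y \<le> N \<and> y \<noteq> Suc x \<and> \<not> (x = 1 \<and> y = N)"
  using assms unfolding diagonals_def by (auto simp: segments_iff sides_iff)

lemma edge_imp_range:
  assumes "3 \<le> N" "T \<subseteq> diagonals N" "edge N T x y"
  shows "1 \<le> x" "x \<le> N" "1 \<le> y" "y \<le> N" "x \<noteq> y"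
proof -
  have "{x, y} \<in> segments N"
    using assms sides_subset_segments unfolding edge_def diagonals_def by blast
  then show "1 \<le> x" "x \<le> N" "1 \<le> y" "y \<le> N" "x \<noteq> y"
    unfolding segments_def by (auto simp: doubleton_eq_iff)
qed

lemma Suc_in_sides: "1 \<le> x \<Longrightarrow> x < N \<Longrightarrow> {x, Suc x} \<in> sides N"
  unfolding sides_def by auto

lemma edge_Suc: "1 \<le> x \<Longrightarrow> x < N \<Longrightarrow> edge N T x (Suc x)"
  by (simp add: edge_def Suc_in_sides)

lemma edge_first_last: "edge N T 1 N"
  unfolding edge_def sides_def by auto

text \<open>A side of the polygon crosses no segment, so counting sides as edges alters neither the
  non-crossing nor the maximality condition. Triangles can then be treated through
  \<open>edge\<close> alone, without separating sides from diagonals.\<close>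

lemma triangulation_iff:
  assumes N: "3 \<le> N"
  shows "triangulation N T \<longleftrightarrow> T \<subseteq> diagonals N \<and>
    (\<forall>x y u v. x < u \<longrightarrow> u < y \<longrightarrow> y < v \<longrightarrow> edge N T x y \<longrightarrow> \<not> edge N T u v) \<and>
    (\<forall>x y. 1 \<le> x \<longrightarrow> x < y \<longrightarrow> y \<le> N \<longrightarrow> \<not> edge N T x y \<longrightarrow>
      (\<exists>u v. edge N T u v \<and> (x < u \<and> u < y \<and> y < v \<or> u < x \<and> x < v \<and> v < y)))"
    (is "_ \<longleftrightarrow> _ \<and> ?nc \<and> ?mx")
proof (cases "T \<subseteq> diagonals N")
  case T: True
  \<comment> \<open>All other vertices lie on the same side of a polygon side, so an edge with a
    vertex \<open>u\<close> strictly between its ends and a vertex \<open>v\<close> outside must be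
    a diagonal.\<close>
  have inT: "{x, y} \<in> T" if "edge N T x y" "x < u" "u < y" "y < v \<or> v < x" "1 \<le> v" "v \<le> N" for x y u v
    using that N by (auto simp: edge_def sides_iff)
  have nc: "(\<forall>d\<in>T. \<forall>e\<in>T. \<not> crossing d e) \<longleftrightarrow> ?nc"
  proof (intro iffI allI impI notI ballI)
    fix x y u v
    assume H: "\<forall>d\<in>T. \<forall>e\<in>T. \<not> crossing d e" and o: "x < u" "u < y" "y < v"
      and e: "edge N T x y" "edge N T u v"
    have "{x, y} \<in> T" "{u, v} \<in> T"
      using inT[OF e(1) o(1,2), of v] inT[OF e(2) o(2,3), of x] o edge_imp_range[OF N T e(1)]
        edge_imp_range[OF N T e(2)] by auto
    then show False
      using H o crossing_iff[of x y u v] by auto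
  next
    fix d e
    assume H: ?nc and d: "d \<in> T" and e: "e \<in> T" and c: "crossing d e"
    obtain x y where xy: "d = {x, y}" "x < y"
      using d T segments_cases unfolding diagonals_def by blast
    obtain u v where uv: "e = {u, v}" "u < v"
      using e T segments_cases unfolding diagonals_def by blast
    have "edge N T x y" "edge N T u v"
      using d e xy uv by (auto simp: edge_def)
    then show False
      using H c crossing_iff[OF xy(2) uv(2)] unfolding xy uv by blast
  qed
  have mx: "(\<forall>d\<in>diagonals N - T. \<exists>e\<in>T. crossing d e) \<longleftrightarrow> ?mx"
  proof (intro iffI allI impI ballI)
    fix x y
    assume H: "\<forall>d\<in>diagonals N - T. \<exists>e\<in>T. crossing d e" and o: "1 \<le> x" "x < y" "y \<le> N"
      and ne: "\<not> edge N T x y"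
    have "{x, y} \<in> diagonals N - T"
      using o ne unfolding edge_def diagonals_def by (auto simp: segments_iff)
    then obtain e where e: "e \<in> T" "crossing {x, y} e" using H by blast
    obtain u v where uv: "e = {u, v}" "u < v"
      using e T segments_cases unfolding diagonals_def by blast
    show "\<exists>u v. edge N T u v \<and> (x < u \<and> u < y \<and> y < v \<or> u < x \<and> x < v \<and> v < y)"
      using e crossing_iff[OF o(2) uv(2)] unfolding uv(1) edge_def Un_iff by blast
  next
    fix d
    assume H: ?mx and d: "d \<in> diagonals N - T"
    obtain x y where xy: "d = {x, y}" "x < y" "1 \<le> x" "y \<le> N"
      using d segments_cases unfolding diagonals_def by blast
    have "\<not> edge N T x y"
      using d xy unfolding edge_def diagonals_def by auto
    then obtain u v where uv: "edge N T u v" and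
      c: "x < u \<and> u < y \<and> y < v \<or> u < x \<and> x < v \<and> v < y"
      using H xy by blast
    have "{u, v} \<in> T"
      using c inT[OF uv, of y x] inT[OF uv, of x y] xy by auto
    moreover have "crossing d {u, v}"
      using c xy crossing_iff[of x y u v] by auto
    ultimately show "\<exists>e\<in>T. crossing d e" by blast
  qed
  show ?thesis using T nc mx unfolding triangulation_def by simp
qed (simp add: triangulation_def)

lemma color_of_eq_iff: "color_of x = color_of y \<longleftrightarrow> x mod 3 = y mod 3"
proof -
  have "x mod 3 < 3" "y mod 3 < 3" by simp_all
  then show ?thesis unfolding color_of_def by auto
qed

lemma colorful_triple_iff:
  "color_of ` {x, y, z} = {Red, Blue, Green} \<longleftrightarrow>
    x mod 3 \<noteq> y mod 3 \<and> y mod 3 \<noteq> z mod 3 \<and> x mod 3 \<noteq> z mod 3"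
  unfolding color_of_eq_iff[symmetric]
  by (cases "color_of x"; cases "color_of y"; cases "color_of z") auto

lemma triangles_eq:
  assumes N: "3 \<le> N" and T: "T \<subseteq> diagonals N"
  shows "triangles N T = {{x, y, z} | x y z. edge N T x y \<and> edge N T y z \<and> edge N T x z}"
proof -
  have "x \<in> {1..N} \<and> y \<in> {1..N} \<and> x \<noteq> y" if "edge N T x y" for x y
    using edge_imp_range[OF N T that] by auto
  then show ?thesis
    unfolding triangles_def edge_def[symmetric] by blast
qed

lemma colorful_iff:
  assumes N: "3 \<le> N"
  shows "T \<in> colorful_triangulations N \<longleftrightarrow> triangulation N T \<and>
    (\<forall>x y z. edge N T x y \<longrightarrow> edge N T y z \<longrightarrow> edge N T x z \<longrightarrow>
      x mod 3 \<noteq> y mod 3 \<and> y mod 3 \<noteq> z mod 3 \<and> x mod 3 \<noteq> z mod 3)"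
proof (cases "triangulation N T")
  case True
  then have "T \<subseteq> diagonals N" by (simp add: triangulation_def)
  then show ?thesis
    using True triangles_eq[OF N] unfolding colorful_triangulations_def
    by (simp add: colorful_triple_iff[symmetric] del: image_insert) blast
qed (simp add: colorful_triangulations_def)

lemma colorfulD:
  assumes N: "3 \<le> N" and T: "T \<in> colorful_triangulations N"
  shows "T \<subseteq> diagonals N"
    and "\<And>x y u v. x < u \<Longrightarrow> u < y \<Longrightarrow> y < v \<Longrightarrow> edge N T x y \<Longrightarrow> \<not> edge N T u v"
    and "\<And>x y. 1 \<le> x \<Longrightarrow> x < y \<Longrightarrow> y \<le> N \<Longrightarrow> \<not> edge N T x y \<Longrightarrow>
      \<exists>u v. edge N T u v \<and> (x < u \<and> u < y \<and> y < v \<or> u < x \<and> x < v \<and> v < y)"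
    and "\<And>x y z. edge N T x y \<Longrightarrow> edge N T y z \<Longrightarrow> edge N T x z \<Longrightarrow>
      x mod 3 \<noteq> y mod 3 \<and> y mod 3 \<noteq> z mod 3 \<and> x mod 3 \<noteq> z mod 3"
  using T unfolding colorful_iff[OF N] triangulation_iff[OF N] by blast+

section \<open>Inserting and cutting off an ear\<close>

definition shift :: "nat \<Rightarrow> nat \<Rightarrow> nat" where
  "shift a x = (if x \<le> a then x else x + 3)"

text \<open>
  The side \<open>{a, a + 1}\<close> of the smaller polygon becomes the diagonal \<open>{a, a + 4}\<close>.
\<close>

definition insert_ear :: "nat \<Rightarrow> nat set set \<Rightarrow> nat set set" where
  "insert_ear a T = (`) (shift a) ` T \<union> {{a, a + 2}, {a + 2, a + 4}, {a, a + 4}}"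

lemma shift_less_iff [simp]: "shift a x < shift a y \<longleftrightarrow> x < y"
  by (auto simp: shift_def)

lemma shift_eq_iff [simp]: "shift a x = shift a y \<longleftrightarrow> x = y"
  by (auto simp: shift_def)

lemma inj_shift: "inj (shift a)"
  by (auto intro: injI)

text \<open>The gap left by \<open>shift\<close> has length three so that old vertices keep their
  colors.\<close>

lemma shift_mod: "shift a x mod 3 = x mod 3"
  by (simp add: shift_def)

lemma shift_cases:
  obtains (new) "x \<in> {Suc a, a + 2, a + 3}" | (old) x' where "x = shift a x'"
proof -
  have "x = shift a x \<or> x \<in> {Suc a, a + 2, a + 3} \<or> x = shift a (x - 3)"
    by (auto simp: shift_def)
  then show thesis using that by blast
qed

text \<open>Old diagonals correspond by injectivity of \<open>shift a\<close>. Sides go to sides,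
  \<open>{1, M}\<close> to \<open>{1, M + 3}\<close>, except that \<open>{a, Suc a}\<close> goes to
  \<open>{a, a + 4}\<close>, which the ear supplies.\<close>

lemma edge_insert_ear_shift:
  assumes M: "3 \<le> M" and a: "1 \<le> a" "a < M" and T: "T \<subseteq> diagonals M"
  shows "edge (M + 3) (insert_ear a T) (shift a x) (shift a y) \<longleftrightarrow> edge M T x y"
proof -
  have im: "{shift a x, shift a y} \<in> (`) (shift a) ` T \<longleftrightarrow> {x, y} \<in> T" for x y
  proof -
    have "{shift a x, shift a y} = shift a ` {x, y}" by simp
    then show ?thesis by (metis (no_types, lifting) image_iff inj_image_eq_iff inj_shift)
  qed
  have *: "edge (M + 3) (insert_ear a T) (shift a x) (shift a y) \<longleftrightarrow> edge M T x y" if "x < y" for x y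
  proof -
    have "{shift a x, shift a y} \<in> {{a, a + 2}, {a + 2, a + 4}, {a, a + 4}} \<union> sides (M + 3)
        \<longleftrightarrow> {x, y} \<in> sides M"
    proof -
      consider "y \<le> a" | "x \<le> a" "a < y" | "a < x" by linarith
      then show ?thesis
        using M a that by cases (auto simp: sides_iff doubleton_eq_iff shift_def)
    qed
    then show ?thesis using im[of x y] unfolding edge_def insert_ear_def Un_iff by argo
  qed
  show ?thesis
  proof (cases x y rule: linorder_cases)
    case equal
    have "\<not> edge (M + 3) (insert_ear a T) (shift a x) (shift a x)"
    proof -
      have "{z} \<notin> sides (M + 3)" for z
        using M by (auto simp: sides_def doubleton_eq_iff)
      moreover have "{z} \<notin> T" for z
        using T by (auto simp: diagonals_def segments_def)
      ultimately show ?thesis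
        using im[of x x] by (auto simp: edge_def insert_ear_def)
    qed
    then show ?thesis using equal edge_imp_range(5)[OF M T] by blast
  next
    case less
    then show ?thesis by (rule *)
  next
    case greater
    then show ?thesis using *[of y x] edge_commute by metis
  qed
qed

text \<open>\<open>shift a\<close> omits the labels \<open>a + 1\<close>, \<open>a + 2\<close>,
  \<open>a + 3\<close>, so only ear diagonals and sides end there.\<close>

lemma edge_insert_ear_new:
  assumes "3 \<le> M" "1 \<le> a" "a < M"
  shows "edge (M + 3) (insert_ear a T) (Suc a) y \<longleftrightarrow> y = a \<or> y = a + 2"
    and "edge (M + 3) (insert_ear a T) (a + 2) y \<longleftrightarrow> y = a \<or> y = Suc a \<or> y = a + 3 \<or> y = a + 4"
    and "edge (M + 3) (insert_ear a T) (a + 3) y \<longleftrightarrow> y = a + 2 \<or> y = a + 4"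
proof -
  have "{x, y} \<notin> (`) (shift a) ` T" if "a < x" "x \<le> a + 3" for x
  proof -
    have "x \<noteq> shift a z" for z using that by (simp add: shift_def)
    then show ?thesis by blast
  qed
  then have new: "edge (M + 3) (insert_ear a T) x y \<longleftrightarrow>
      {x, y} \<in> {{a, a + 2}, {a + 2, a + 4}, {a, a + 4}} \<or> y = x + 1 \<or> y + 1 = x"
    if "a < x" "x \<le> a + 3" for x
    using that assms unfolding edge_def insert_ear_def sides_def by (auto simp: doubleton_eq_iff)
  show "edge (M + 3) (insert_ear a T) (Suc a) y \<longleftrightarrow> y = a \<or> y = a + 2"
    by (subst new) (auto simp: doubleton_eq_iff)
  show "edge (M + 3) (insert_ear a T) (a + 2) y \<longleftrightarrow> y = a \<or> y = Suc a \<or> y = a + 3 \<or> y = a + 4"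
    by (subst new) (auto simp: doubleton_eq_iff)
  show "edge (M + 3) (insert_ear a T) (a + 3) y \<longleftrightarrow> y = a + 2 \<or> y = a + 4"
    by (subst new) (auto simp: doubleton_eq_iff)
qed

lemma insert_ear_subset_diagonals:
  assumes M: "3 \<le> M" and a: "1 \<le> a" "a < M" and T: "T \<subseteq> diagonals M"
  shows "insert_ear a T \<subseteq> diagonals (M + 3)"
proof
  fix d assume "d \<in> insert_ear a T"
  then consider d' where "d' \<in> T" "d = shift a ` d'"
    | "d \<in> {{a, a + 2}, {a + 2, a + 4}, {a, a + 4}}"
    unfolding insert_ear_def by blast
  then show "d \<in> diagonals (M + 3)"
  proof cases
    case 1
    then obtain x y where xy: "d' = {x, y}" "x < y"
      using T segments_cases unfolding diagonals_def by blast
    have "{x, y} \<in> diagonals M" using 1 xy T by blast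
    then have "1 \<le> x" "y \<le> M" "y \<noteq> Suc x" "\<not> (x = 1 \<and> y = M)"
      using diagonals_iff[OF xy(2) M] by auto
    moreover have "shift a x < shift a y" using xy by simp
    ultimately have "{shift a x, shift a y} \<in> diagonals (M + 3)"
      using xy(2) M a diagonals_iff[of "shift a x" "shift a y" "M + 3"]
      by (simp add: shift_def split: if_splits)
    then show ?thesis using 1 xy by simp
  next
    case 2
    then show ?thesis using M a by (auto simp: diagonals_iff)
  qed
qed

text \<open>On shifted labels each condition is inherited from \<open>T\<close> by
  \<open>edge_insert_ear_shift\<close>; as soon as a new label is involved, the explicit neighbor
  lists decide.\<close>

lemma insert_ear_colorful:
  assumes M: "3 \<le> M" and a: "1 \<le> a" "a < M" and T: "T \<in> colorful_triangulations M"
  shows "insert_ear a T \<in> colorful_triangulations (M + 3)"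
proof -
  let ?e = "edge (M + 3) (insert_ear a T)"
  have M3: "3 \<le> M + 3" by simp
  note TD = colorfulD(1)[OF M T] and nc = colorfulD(2)[OF M T] and mx = colorfulD(3)[OF M T]
    and col = colorfulD(4)[OF M T]
  note old = edge_insert_ear_shift[OF M a TD]
  note new = edge_insert_ear_new[OF M a, of T]
  have new': "?e y (Suc a) \<longleftrightarrow> y = a \<or> y = a + 2"
    "?e y (a + 2) \<longleftrightarrow> y = a \<or> y = Suc a \<or> y = a + 3 \<or> y = a + 4"
    "?e y (a + 3) \<longleftrightarrow> y = a + 2 \<or> y = a + 4" for y
    using new edge_commute by metis+
  have nc': "\<not> ?e u v" if o: "x < u" "u < y" "y < v" and e: "?e x y" for x y u v
  proof
    assume e': "?e u v"
    \<comment> \<open>The tips \<open>a + 1\<close> and \<open>a + 3\<close> are excluded first,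
      because an edge interleaving with one at \<open>a + 2\<close> would have to end at a
      tip.\<close>
    have nx: "x \<notin> {Suc a, a + 3}" "y \<notin> {Suc a, a + 3}" "u \<notin> {Suc a, a + 3}" "v \<notin> {Suc a, a + 3}"
      using o e e' new new' by auto
    have "x \<noteq> a + 2" "y \<noteq> a + 2" "u \<noteq> a + 2" "v \<noteq> a + 2"
      using o e e' new new' nx by auto
    with nx obtain x' y' u' v' where
      "x = shift a x'" "y = shift a y'" "u = shift a u'" "v = shift a v'"
      using shift_cases by (metis insert_iff singletonD)
    then show False using nc[of x' u' y' v'] o e e' old by simp
  qed
  have mx': "\<exists>u v. ?e u v \<and> (x < u \<and> u < y \<and> y < v \<or> u < x \<and> x < v \<and> v < y)"
    if o: "1 \<le> x" "x < y" "y \<le> M + 3" and ne: "\<not> ?e x y" for x y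
  proof -
    have e3: "?e a (a + 2)" "?e (a + 2) (a + 4)" "?e a (a + 4)"
      by (auto simp: edge_def insert_ear_def)
    show ?thesis
    proof (cases "x \<in> {Suc a, a + 2, a + 3} \<or> y \<in> {Suc a, a + 2, a + 3}")
      case True
      then consider "x = Suc a" | "y = Suc a" | "x = a + 3" | "y = a + 3" | "x = a + 2" | "y = a + 2"
        by blast
      \<comment> \<open>A missing segment at a new vertex crosses an ear diagonal: at
        \<open>a + 1\<close> it crosses \<open>{a, a + 2}\<close>, at \<open>a + 3\<close> it
        crosses \<open>{a + 2, a + 4}\<close>, and at \<open>a + 2\<close> it crosses
        \<open>{a, a + 4}\<close>.\<close>
      then have "(x < a \<and> a < y \<and> y < a + 2 \<or> a < x \<and> x < a + 2 \<and> a + 2 < y)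
        \<or> (x < a + 2 \<and> a + 2 < y \<and> y < a + 4 \<or> a + 2 < x \<and> x < a + 4 \<and> a + 4 < y)
        \<or> (x < a \<and> a < y \<and> y < a + 4 \<or> a < x \<and> x < a + 4 \<and> a + 4 < y)"
        using o ne new[of y] new'[of x] by cases auto
      then show ?thesis using e3 by blast
    next
      case False
      then obtain x' y' where xy: "x = shift a x'" "y = shift a y'"
        using shift_cases by metis
      have "1 \<le> x'" "x' < y'" "y' \<le> M"
        using o xy a by (auto simp: shift_def split: if_splits)
      then obtain u v where "edge M T u v"
        "x' < u \<and> u < y' \<and> y' < v \<or> u < x' \<and> x' < v \<and> v < y'"
        using mx[of x' y'] ne xy old by blast
      then show ?thesis
        unfolding xy using old by (metis shift_less_iff)
    qed
  qed
  \<comment> \<open>The triangles with a new vertex are the middle triangle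
    \<open>{a, a + 2, a + 4}\<close> of the ear and the two tips cut off by its short
    diagonals.\<close>
  have colnew: "w mod 3 \<noteq> p mod 3 \<and> p mod 3 \<noteq> q mod 3 \<and> w mod 3 \<noteq> q mod 3"
    if w: "w \<in> {Suc a, a + 2, a + 3}" and e: "?e w p" "?e p q" "?e w q" for w p q
  proof -
    have pq: "p \<noteq> q"
      using edge_imp_range(5)[OF M3 insert_ear_subset_diagonals[OF M a TD] e(2)] .
    have m: "a mod 3 \<noteq> (Suc a) mod 3" "a mod 3 \<noteq> (a + 2) mod 3" "(Suc a) mod 3 \<noteq> (a + 2) mod 3"
      "(a + 3) mod 3 = a mod 3" "(a + 4) mod 3 = (Suc a) mod 3"
      by presburger+
    consider "w = Suc a" | "w = a + 2" | "w = a + 3" using w by blast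
    then show ?thesis
    proof cases
      case 1
      then have "p = a \<and> q = a + 2 \<or> p = a + 2 \<and> q = a" using e new(1)[of p] new(1)[of q] pq by simp blast
      then show ?thesis using m 1 by metis
    next
      case 2
      then have P: "p = a \<or> p = Suc a \<or> p = a + 3 \<or> p = a + 4"
        and Q: "q = a \<or> q = Suc a \<or> q = a + 3 \<or> q = a + 4" using e new(2) by blast+
      have "p = a \<and> q = Suc a \<or> p = Suc a \<and> q = a \<or> p = a \<and> q = a + 4 \<or> p = a + 4 \<and> q = a
          \<or> p = a + 3 \<and> q = a + 4 \<or> p = a + 4 \<and> q = a + 3"
        using P Q pq e(2) by (elim disjE) (simp_all add: new new')
      then show ?thesis using m 2 by metis
    next
      case 3
      then have "p = a + 2 \<and> q = a + 4 \<or> p = a + 4 \<and> q = a + 2" using e new(3)[of p] new(3)[of q] pq by simp blast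
      then show ?thesis using m 3 by metis
    qed
  qed
  have col': "x mod 3 \<noteq> y mod 3 \<and> y mod 3 \<noteq> z mod 3 \<and> x mod 3 \<noteq> z mod 3"
    if e: "?e x y" "?e y z" "?e x z" for x y z
  proof (cases "x \<in> {Suc a, a + 2, a + 3} \<or> y \<in> {Suc a, a + 2, a + 3} \<or> z \<in> {Suc a, a + 2, a + 3}")
    case True
    then show ?thesis
      using colnew[of x y z] colnew[of y x z] colnew[of z x y] e edge_commute[of _ _ y x]
        edge_commute[of _ _ z x] edge_commute[of _ _ z y] by metis
  next
    case False
    then obtain x' y' z' where "x = shift a x'" "y = shift a y'" "z = shift a z'"
      using shift_cases by metis
    then show ?thesis using col[of x' y' z'] e old by (simp add: shift_mod)
  qed
  show ?thesis
    unfolding colorful_iff[OF M3] triangulation_iff[OF M3]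
    using insert_ear_subset_diagonals[OF M a TD] nc' mx' col' by blast
qed

text \<open>This inverts \<open>insert_ear\<close>: the ear isolates the three new vertices, so all
  remaining edges come from the smaller polygon.\<close>

lemma colorful_eq_insert_ear:
  assumes M: "3 \<le> M" and a: "1 \<le> a" "a < M" and T: "T \<in> colorful_triangulations (M + 3)"
    and ear: "{{a, a + 2}, {a + 2, a + 4}, {a, a + 4}} \<subseteq> T"
  obtains T' where "T' \<in> colorful_triangulations M" "T = insert_ear a T'"
proof -
  let ?e = "edge (M + 3) T"
  \<comment> \<open>Restricting to \<open>diagonals M\<close> keeps out the side
    \<open>{a, Suc a}\<close>, whose image \<open>{a, a + 4}\<close> lies in
    \<open>T\<close>.\<close>
  define T' where "T' = {d \<in> diagonals M. shift a ` d \<in> T}"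
  have M3: "3 \<le> M + 3" by simp
  note TD = colorfulD(1)[OF M3 T] and nc = colorfulD(2)[OF M3 T] and mx = colorfulD(3)[OF M3 T]
    and col = colorfulD(4)[OF M3 T]
  have TD': "T' \<subseteq> diagonals M" by (auto simp: T'_def)
  have e: "?e a (a + 2)" "?e (a + 2) (a + 4)" "?e a (a + 4)"
    using ear by (auto simp: edge_def)
  \<comment> \<open>Since no edge crosses an ear diagonal, the new vertices have no neighbors beyond
    those listed in \<open>edge_insert_ear_new\<close>.\<close>
  have nb1: "y = a \<or> y = a + 2" if "?e (Suc a) y" for y
  proof -
    have "?e y (Suc a)" "y \<noteq> Suc a"
      using that edge_commute edge_imp_range(5)[OF M3 TD that] by blast+
    then show ?thesis
      using nc[of a "Suc a" "a + 2" y] nc[of y a "Suc a" "a + 2"] e that by force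
  qed
  have nb3: "y = a + 2 \<or> y = a + 4" if "?e (a + 3) y" for y
  proof -
    have "?e y (a + 3)" "y \<noteq> a + 3"
      using that edge_commute edge_imp_range(5)[OF M3 TD that] by blast+
    then show ?thesis
      using nc[of "a + 2" "a + 3" "a + 4" y] nc[of y "a + 2" "a + 3" "a + 4"] e that by force
  qed
  have nb2: "y = a \<or> y = Suc a \<or> y = a + 3 \<or> y = a + 4" if "?e (a + 2) y" for y
  proof -
    have "?e y (a + 2)" "y \<noteq> a + 2"
      using that edge_commute edge_imp_range(5)[OF M3 TD that] by blast+
    then show ?thesis
      using nc[of a "a + 2" "a + 4" y] nc[of y a "a + 2" "a + 4"] e that by force
  qed
  have new: "{x, y} \<in> {{a, a + 2}, {a + 2, a + 4}}"
    if "{x, y} \<in> T" "x \<in> {Suc a, a + 2, a + 3}" for x y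
  proof -
    have e: "?e x y" using that by (simp add: edge_def)
    have "{x, y} \<notin> sides (M + 3)" using that TD by (auto simp: diagonals_def)
    moreover have "1 \<le> y" using that(1) TD by (auto simp: diagonals_def segments_def doubleton_eq_iff)
    ultimately have "y \<noteq> Suc x" "x \<noteq> Suc y"
      using a that(2) Suc_in_sides[of x "M + 3"] Suc_in_sides[of y "M + 3"]
      by (auto simp: insert_commute)
    then show ?thesis using e that(2) nb1[of y] nb2[of y] nb3[of y] by auto
  qed
  have "T = insert_ear a T'"
  proof
    show "insert_ear a T' \<subseteq> T" using ear by (auto simp: insert_ear_def T'_def)
    show "T \<subseteq> insert_ear a T'"
    proof
      fix d assume d: "d \<in> T"
      then obtain x y where xy: "d = {x, y}" "x < y" "1 \<le> x" "y \<le> M + 3"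
        using TD segments_cases unfolding diagonals_def by blast
      show "d \<in> insert_ear a T'"
      proof (cases "x \<in> {Suc a, a + 2, a + 3} \<or> y \<in> {Suc a, a + 2, a + 3}")
        case True
        then have "d \<in> {{a, a + 2}, {a + 2, a + 4}}"
          using new[of x y] new[of y x] d xy by (metis insert_commute)
        then show ?thesis by (auto simp: insert_ear_def)
      next
        case False
        then obtain x' y' where s: "x = shift a x'" "y = shift a y'"
          using shift_cases by metis
        have o: "x' < y'" "1 \<le> x'" "y' \<le> M"
          using xy s a by (auto simp: shift_def split: if_splits)
        show ?thesis
        proof (cases "{x', y'} \<in> diagonals M")
          case True
          then have "{x', y'} \<in> T'" using d xy s by (simp add: T'_def)
          then have "shift a ` {x', y'} \<in> insert_ear a T'" unfolding insert_ear_def by blast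
          then show ?thesis by (simp add: xy s)
        next
          case False
          \<comment> \<open>The only side of the smaller polygon that is not sent to a side is
            \<open>{a, Suc a}\<close>.\<close>
          then have "y' = Suc x' \<or> x' = 1 \<and> y' = M"
            using o diagonals_iff[OF o(1) M] by auto
          moreover have "y \<noteq> Suc x" "\<not> (x = 1 \<and> y = M + 3)"
            using d TD diagonals_iff[OF xy(2) M3] unfolding xy by blast+
          ultimately have "x = a \<and> y = a + 4"
            using s a o by (auto simp: shift_def split: if_splits)
          then show ?thesis by (simp add: insert_ear_def xy)
        qed
      qed
    qed
  qed
  have old: "edge M T' x y \<longleftrightarrow> ?e (shift a x) (shift a y)" for x y
    using edge_insert_ear_shift[OF M a TD', of x y] \<open>T = insert_ear a T'\<close> by simp
  have "T' \<in> colorful_triangulations M"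
    unfolding colorful_iff[OF M] triangulation_iff[OF M]
  proof (intro conjI allI impI)
    show "T' \<subseteq> diagonals M" by (fact TD')
  next
    fix x y u v assume "x < u" "u < y" "y < v" "edge M T' x y"
    then show "\<not> edge M T' u v"
      using nc[of "shift a x" "shift a u" "shift a y" "shift a v"] by (simp add: old)
  next
    fix x y assume o: "1 \<le> x" "x < y" "y \<le> M" and ne: "\<not> edge M T' x y"
    have "1 \<le> shift a x" "shift a x < shift a y" "shift a y \<le> M + 3"
      using o by (auto simp: shift_def)
    then obtain u v where uv: "?e u v" and c: "shift a x < u \<and> u < shift a y \<and> shift a y < v \<or>
        u < shift a x \<and> shift a x < v \<and> v < shift a y"
      using mx[of "shift a x" "shift a y"] ne old by blast
    have vu: "?e v u" using uv edge_commute by blast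
    have xy: "shift a z \<noteq> Suc a" "shift a z \<noteq> a + 2" "shift a z \<noteq> a + 3" for z
      by (auto simp: shift_def)
    \<comment> \<open>An edge at a new vertex stays within \<open>a, ..., a + 4\<close>. To cross
      it, a shifted segment would need an endpoint strictly inside this range, where
      \<open>shift a\<close> takes no value.\<close>
    have "u \<notin> {Suc a, a + 2, a + 3}"
    proof
      assume "u \<in> {Suc a, a + 2, a + 3}"
      then consider "u = Suc a" | "u = a + 2" | "u = a + 3" by blast
      then show False
      proof cases
        case 1
        then have "v = a \<or> v = a + 2" using nb1 uv by blast
        then show False using c 1 xy[of x] xy[of y] by arith
      next
        case 2
        then have "v = a \<or> v = Suc a \<or> v = a + 3 \<or> v = a + 4" using nb2 uv by blast
        then show False using c 2 xy[of x] xy[of y] by arith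
      next
        case 3
        then have "v = a + 2 \<or> v = a + 4" using nb3 uv by blast
        then show False using c 3 xy[of x] xy[of y] by arith
      qed
    qed
    moreover have "v \<notin> {Suc a, a + 2, a + 3}"
    proof
      assume "v \<in> {Suc a, a + 2, a + 3}"
      then consider "v = Suc a" | "v = a + 2" | "v = a + 3" by blast
      then show False
      proof cases
        case 1
        then have "u = a \<or> u = a + 2" using nb1 vu by blast
        then show False using c 1 xy[of x] xy[of y] by arith
      next
        case 2
        then have "u = a \<or> u = Suc a \<or> u = a + 3 \<or> u = a + 4" using nb2 vu by blast
        then show False using c 2 xy[of x] xy[of y] by arith
      next
        case 3
        then have "u = a + 2 \<or> u = a + 4" using nb3 vu by blast
        then show False using c 3 xy[of x] xy[of y] by arith
      qed
    qed
    ultimately obtain u' v' where "u = shift a u'" "v = shift a v'"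
      using shift_cases by metis
    then show "\<exists>u v. edge M T' u v \<and> (x < u \<and> u < y \<and> y < v \<or> u < x \<and> x < v \<and> v < y)"
      using uv c old by (intro exI[of _ u'] exI[of _ v']) simp
  next
    fix x y z assume "edge M T' x y" "edge M T' y z" "edge M T' x z"
    then have "shift a x mod 3 \<noteq> shift a y mod 3 \<and> shift a y mod 3 \<noteq> shift a z mod 3 \<and>
        shift a x mod 3 \<noteq> shift a z mod 3"
      using col[of "shift a x" "shift a y" "shift a z"] by (simp add: old)
    then show "x mod 3 \<noteq> y mod 3" "y mod 3 \<noteq> z mod 3" "x mod 3 \<noteq> z mod 3"
      by (simp_all add: shift_mod)
  qed
  then show thesis using that \<open>T = insert_ear a T'\<close> by blast
qed

section \<open>Orientation of colored triangles and existence of an ear\<close>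

lemma diff_mod_3:
  fixes x y z :: nat
  assumes "x < z" "z < y" "x mod 3 \<noteq> z mod 3" "z mod 3 \<noteq> y mod 3"
  shows "(y - x) mod 3 = 1 \<Longrightarrow> (z - x) mod 3 = 2 \<and> (y - z) mod 3 = 2"
    and "(y - x) mod 3 = 2 \<Longrightarrow> (z - x) mod 3 = 1 \<and> (y - z) mod 3 = 1"
proof -
  have ne: "p mod 3 = 1 \<or> p mod 3 = 2" if "x mod 3 \<noteq> (x + p) mod 3" for x p :: nat
  proof -
    have "p mod 3 \<noteq> 0" using that by (metis add.right_neutral mod_add_right_eq)
    moreover have "p mod 3 < 3" by simp
    ultimately show ?thesis by linarith
  qed
  have "(z - x) mod 3 = 1 \<or> (z - x) mod 3 = 2" "(y - z) mod 3 = 1 \<or> (y - z) mod 3 = 2"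
    using ne[of x "z - x"] ne[of z "y - z"] assms by simp_all
  \<comment> \<open>Both short spans are 1 or 2 modulo 3 and add up to the long one, so 1 arises
    only as 2 + 2 and 2 only as 1 + 1.\<close>
  moreover have "(y - x) mod 3 = ((z - x) mod 3 + (y - z) mod 3) mod 3"
    using assms by (simp add: mod_add_eq)
  ultimately show "(y - x) mod 3 = 1 \<Longrightarrow> (z - x) mod 3 = 2 \<and> (y - z) mod 3 = 2"
    and "(y - x) mod 3 = 2 \<Longrightarrow> (z - x) mod 3 = 1 \<and> (y - z) mod 3 = 1"
    by auto
qed

text \<open>The apex is the largest neighbor \<open>z\<close> of \<open>x\<close> below
  \<open>y\<close>. If \<open>{z, y}\<close> were not an edge, maximality would give an edge
  crossing it, and this edge would cross \<open>{x, y}\<close> or \<open>{x, z}\<close> or join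
  \<open>x\<close> to a vertex beyond \<open>z\<close>.\<close>

lemma colorful_apex:
  assumes N: "3 \<le> N" and T: "T \<in> colorful_triangulations N"
    and e: "edge N T x y" and xy: "Suc x < y"
  obtains z where "x < z" "z < y" "edge N T x z" "edge N T z y"
    "x mod 3 \<noteq> z mod 3" "z mod 3 \<noteq> y mod 3" "x mod 3 \<noteq> y mod 3"
proof -
  note TD = colorfulD(1)[OF N T] and nc = colorfulD(2)[OF N T] and mx = colorfulD(3)[OF N T]
    and col = colorfulD(4)[OF N T]
  note r = edge_imp_range[OF N TD e]
  define Z where "Z = {z. x < z \<and> z < y \<and> edge N T x z}"
  have "Suc x \<in> Z" using edge_Suc[of x N T] r xy by (simp add: Z_def)
  moreover have fin: "finite Z" by (rule finite_subset[of _ "{..<y}"]) (auto simp: Z_def)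
  ultimately have "Max Z \<in> Z" by (metis Max_in empty_iff)
  then obtain z where z: "x < z" "z < y" "edge N T x z" and max: "\<And>w. w \<in> Z \<Longrightarrow> w \<le> z"
    using fin Max_ge by (auto simp: Z_def)
  have "edge N T z y"
  proof (rule ccontr)
    assume "\<not> edge N T z y"
    then obtain u v where uv: "edge N T u v"
      and c: "z < u \<and> u < y \<and> y < v \<or> u < z \<and> z < v \<and> v < y"
      using mx[of z y] z r by auto
    from c show False
    proof
      assume "z < u \<and> u < y \<and> y < v"
      then show False using nc[of x u y v] z e uv by auto
    next
      assume c: "u < z \<and> z < v \<and> v < y"
      consider "u < x" | "u = x" | "x < u" by linarith
      then show False
      proof cases
        case 1
        then show False using nc[of u x v y] z e uv c by auto
      next
        case 2
        then have "v \<in> Z" using c uv z by (auto simp: Z_def)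
        then show False using max c by fastforce
      next
        case 3
        then show False using nc[of x u z v] z uv c by auto
      qed
    qed
  qed
  then show thesis using that[of z] z col[of x z y] e by auto
qed

lemma colorful_has_ear:
  assumes N: "6 \<le> N" "3 dvd N" and T: "T \<in> colorful_triangulations N"
  obtains a where "1 \<le> a" "a + 4 \<le> N" "{{a, a + 2}, {a + 2, a + 4}, {a, a + 4}} \<subseteq> T"
proof -
  have N3: "3 \<le> N" using N by simp
  note TD = colorfulD(1)[OF N3 T]
  note apex = colorful_apex[OF N3 T]
  \<comment> \<open>the possible spans of clockwise triangles\<close>
  define P where "P d \<longleftrightarrow> (\<exists>x y. edge N T x y \<and> y = x + d \<and> 1 < d \<and> d mod 3 = 1)" for d
  have "\<exists>d. P d"
  proof -
    have N1: "Suc 1 < N" using N by simp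
    \<comment> \<open>As \<open>N\<close> is 0 modulo 3, the apex over \<open>{1, N}\<close> is 2
      modulo 3. Then \<open>{1, z}\<close> has span 1 modulo 3, and if it is just a side, so that
      \<open>z = 2\<close>, the edge \<open>{2, N}\<close> serves instead.\<close>
    obtain z where z: "1 < z" "z < N" "edge N T 1 z" "edge N T z N"
      "1 mod 3 \<noteq> z mod 3" "z mod 3 \<noteq> N mod 3"
      using apex[OF edge_first_last N1] by metis
    have m: "z mod 3 = 2" 
    proof -
      have "z mod 3 < 3" "N mod 3 = 0" using N(2) by auto
      then show ?thesis using z(5,6) by simp
    qed
    show ?thesis
    proof (cases "z = 2")
      case True
      obtain k where "N = 3 * k" using N(2) by blast
      then have "N - 2 = 1 + 3 * (k - 1)" using N(1) by (simp add: diff_mult_distrib2)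
      then have "(N - 2) mod 3 = 1" by simp
      then have "P (N - 2)" using True z N unfolding P_def
        by (intro exI[of _ 2] exI[of _ N]) auto
      then show ?thesis ..
    next
      case False
      obtain k where "z = 3 * k + 2" using m by (metis mult_div_mod_eq)
      then have "(z - 1) mod 3 = 1" by simp
      then have "P (z - 1)" using z False unfolding P_def
        by (intro exI[of _ 1] exI[of _ z]) auto
      then show ?thesis ..
    qed
  qed
  then obtain d where d: "P d" and min: "\<And>d'. d' < d \<Longrightarrow> \<not> P d'"
    using exists_least_iff[of P] by blast
  then obtain x y where xy: "edge N T x y" "y = x + d" "1 < d" "d mod 3 = 1"
    unfolding P_def by blast
  \<comment> \<open>The triangle below such an edge has short spans that are 1 modulo 3 and less
    than \<open>d\<close>. Minimality of \<open>d\<close> forces both to be 1.\<close>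
  have two: "v = u + 2" if e: "edge N T u v" and o: "u < v" "v < u + d"
    and m: "(v - u) mod 3 = 2" for u v
  proof -
    have "v \<noteq> Suc u" using m by auto
    then have "Suc u < v" using o by simp
    then obtain w where w: "u < w" "w < v" "edge N T u w" "edge N T w v"
      "u mod 3 \<noteq> w mod 3" "w mod 3 \<noteq> v mod 3"
      using apex[OF e] by metis
    have "(w - u) mod 3 = 1" "(v - w) mod 3 = 1"
      using diff_mod_3(2)[OF w(1,2,5,6) m] by blast+
    then have "1 < w - u \<Longrightarrow> P (w - u)" "1 < v - w \<Longrightarrow> P (v - w)"
      using w unfolding P_def by (metis le_add_diff_inverse less_imp_le)+
    moreover have "\<not> P (w - u)" "\<not> P (v - w)" using w o by (auto intro!: min)
    ultimately have "w - u = 1" "v - w = 1"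
      using w by (metis less_one linorder_neqE_nat not_less_zero zero_less_diff)+
    then show ?thesis by linarith
  qed
  have "Suc x < y" using xy by simp
  then obtain z where z: "x < z" "z < y" "edge N T x z" "edge N T z y"
      "x mod 3 \<noteq> z mod 3" "z mod 3 \<noteq> y mod 3"
    using apex[OF xy(1)] by metis
  \<comment> \<open>Both short sides over the minimal edge now have span exactly 2, whence
    \<open>d = 4\<close>.\<close>
  have "(z - x) mod 3 = 2" "(y - z) mod 3 = 2" 
    using diff_mod_3(1)[OF z(1,2,5,6)] xy by simp_all
  then have zx: "z = x + 2" and yz: "y = z + 2"
    using two[of x z] two[of z y] z xy by auto
  have e: "edge N T x (x + 2)" "edge N T (x + 2) (x + 4)" "edge N T x (x + 4)"
    using z(3,4) xy(1) unfolding yz unfolding zx by (simp_all add: numeral_eq_Suc)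
  have r: "1 \<le> x" "x + 4 \<le> N" using edge_imp_range[OF N3 TD e(3)] by auto
  \<comment> \<open>None of these edges is a side: the spans 2 and 4 differ from 1 and from
    \<open>N - 1\<close>.\<close>
  have "{{x, x + 2}, {x + 2, x + 4}, {x, x + 4}} \<subseteq> T"
    using e r N unfolding edge_def by (auto simp: sides_iff)
  then show thesis using that r by blast
qed

section \<open>Lifting twists and twisting between consecutive ears\<close>

lemma circular_order_shift:
  assumes "circular_order hs"
  shows "circular_order (map (shift a) hs)"
  using assms unfolding circular_order_def by (auto simp: rotate_map sorted_wrt_map)

text \<open>Between the labels of two odd-indexed hexagon vertices lies another hexagon vertex.
  Hence a twist never removes a segment \<open>{a, Suc a}\<close>, whose lift would be the ear
  diagonal \<open>{a, a + 4}\<close>.\<close>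

lemma circular_order_not_adjacent:
  assumes "circular_order [h1, h2, h3, h4, h5, h6]"
  shows "\<forall>c. {h1, h3} \<noteq> {c, Suc c} \<and> {h3, h5} \<noteq> {c, Suc c} \<and> {h5, h1} \<noteq> {c, Suc c}"
proof -
  obtain k where "sorted_wrt (<) (rotate k [h1, h2, h3, h4, h5, h6])"
    using assms unfolding circular_order_def by blast
  then have "sorted_wrt (<) (rotate (k mod 6) [h1, h2, h3, h4, h5, h6])"
    using rotate_conv_mod[of k "[h1, h2, h3, h4, h5, h6]"] by simp
  moreover have "k mod 6 < 6" by simp
  ultimately obtain j where j: "j < 6" "sorted_wrt (<) (rotate j [h1, h2, h3, h4, h5, h6])"
    by blast
  from j(1) have "j = 0 \<or> j = 1 \<or> j = 2 \<or> j = 3 \<or> j = 4 \<or> j = 5" by linarith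
  then have "h1 < h2 \<and> h2 < h3 \<and> h3 < h4 \<and> h4 < h5 \<and> h5 < h6 \<or>
      h2 < h3 \<and> h3 < h4 \<and> h4 < h5 \<and> h5 < h6 \<and> h6 < h1 \<or>
      h3 < h4 \<and> h4 < h5 \<and> h5 < h6 \<and> h6 < h1 \<and> h1 < h2 \<or>
      h4 < h5 \<and> h5 < h6 \<and> h6 < h1 \<and> h1 < h2 \<and> h2 < h3 \<or>
      h5 < h6 \<and> h6 < h1 \<and> h1 < h2 \<and> h2 < h3 \<and> h3 < h4 \<or>
      h6 < h1 \<and> h1 < h2 \<and> h2 < h3 \<and> h3 < h4 \<and> h4 < h5"
    using j(2) by (elim disjE) (simp_all add: rotate_def eval_nat_numeral)
  then have "(Suc h1 < h3 \<or> Suc h3 < h1) \<and> (Suc h3 < h5 \<or> Suc h5 < h3) \<and> (Suc h5 < h1 \<or> Suc h1 < h5)"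
    by (elim disjE conjE) simp_all
  then show ?thesis by (auto simp: doubleton_eq_iff)
qed

lemma triangles_insert_ear:
  assumes M: "3 \<le> M" and a: "1 \<le> a" "a < M" and T: "T \<subseteq> diagonals M"
    and t: "{x, y, z} \<in> triangles M T"
  shows "{shift a x, shift a y, shift a z} \<in> triangles (M + 3) (insert_ear a T)"
proof -
  have M3: "3 \<le> M + 3" by simp
  obtain p q r where e: "{x, y, z} = {p, q, r}" "edge M T p q" "edge M T q r" "edge M T p r"
    using t unfolding triangles_eq[OF M T] by blast
  have "{shift a x, shift a y, shift a z} = {shift a p, shift a q, shift a r}"
    using arg_cong[OF e(1), of "(`) (shift a)"] by simp
  then show ?thesis
    using e(2-) unfolding triangles_eq[OF M3 insert_ear_subset_diagonals[OF M a T]]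
      edge_insert_ear_shift[OF M a T, symmetric] by blast
qed

text \<open>Circular order and triangles are preserved by \<open>shift a\<close>; what remains is
  that the lifted deletion leaves the ear intact.\<close>

lemma twist_insert_ear:
  assumes M: "3 \<le> M" and a: "1 \<le> a" "a < M" and T: "T \<subseteq> diagonals M" and tw: "twist M T T'"
  shows "twist (M + 3) (insert_ear a T) (insert_ear a T')"
proof -
  obtain h1 h2 h3 h4 h5 h6 where c: "circular_order [h1, h2, h3, h4, h5, h6]"
    and t: "{{h1, h3, h5}, {h1, h2, h3}, {h3, h4, h5}, {h5, h6, h1}} \<subseteq> triangles M T"
    and T': "T' = (T - {{h1, h3}, {h3, h5}, {h5, h1}}) \<union> {{h2, h4}, {h4, h6}, {h6, h2}}"
    using tw unfolding twist_def by blast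
  let ?s = "shift a"
  have "circular_order [?s h1, ?s h2, ?s h3, ?s h4, ?s h5, ?s h6]"
    using circular_order_shift[OF c, of a] by simp
  moreover have "{{?s h1, ?s h3, ?s h5}, {?s h1, ?s h2, ?s h3}, {?s h3, ?s h4, ?s h5},
      {?s h5, ?s h6, ?s h1}} \<subseteq> triangles (M + 3) (insert_ear a T)"
    using t triangles_insert_ear[OF M a T] by simp
  moreover have "insert_ear a T' = (insert_ear a T - {{?s h1, ?s h3}, {?s h3, ?s h5}, {?s h5, ?s h1}}) \<union>
      {{?s h2, ?s h4}, {?s h4, ?s h6}, {?s h6, ?s h2}}"
  proof -
    define X where "X = {{a, a + 2}, {a + 2, a + 4}, {a, a + 4}}"
    have "{?s x, ?s y} \<notin> X" if "\<forall>c. {x, y} \<noteq> {c, Suc c}" for x y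
    proof -
      have "?s x \<noteq> a + 2" "?s y \<noteq> a + 2" by (auto simp: shift_def)
      moreover have "{?s x, ?s y} \<noteq> {a, a + 4}"
      proof
        assume "{?s x, ?s y} = {a, a + 4}"
        moreover have "?s a = a" "?s (Suc a) = a + 4" by (simp_all add: shift_def)
        ultimately have "{?s x, ?s y} = {?s a, ?s (Suc a)}" by simp
        then have "{x, y} = {a, Suc a}" by (simp add: doubleton_eq_iff)
        then show False using that by blast
      qed
      ultimately show ?thesis by (auto simp: X_def doubleton_eq_iff)
    qed
    then have X: "X - {{?s h1, ?s h3}, {?s h3, ?s h5}, {?s h5, ?s h1}} = X"
      using circular_order_not_adjacent[OF c] by simp
    have "inj ((`) ?s)"
      by (rule injI) (simp add: inj_image_eq_iff[OF inj_shift])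
    then have "(`) ?s ` T' = ((`) ?s ` T - {{?s h1, ?s h3}, {?s h3, ?s h5}, {?s h5, ?s h1}}) \<union>
        {{?s h2, ?s h4}, {?s h4, ?s h6}, {?s h6, ?s h2}}"
      unfolding T' image_Un by (subst image_set_diff) simp_all
    then show ?thesis
      unfolding insert_ear_def X_def[symmetric] Un_Diff X by (simp only: Un_ac)
  qed
  ultimately show ?thesis unfolding twist_def by blast
qed

text \<open>The edge \<open>{a, a + 2}\<close> cuts off the vertex \<open>a + 1\<close>, so no
  diagonal of \<open>T\<close> ends there, and \<open>shift a\<close> and
  \<open>shift (Suc a)\<close> differ only at that label. The two results thus differ only in their
  ears. For \<open>M = 3\<close> this edge is a side, hence the use of \<open>edge\<close>.\<close>

lemma twist_insert_ear_Suc: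
  assumes M: "3 \<le> M" and a: "1 \<le> a" "a + 2 \<le> M" and T: "T \<in> colorful_triangulations M"
    and e: "edge M T a (a + 2)"
  shows "twist (M + 3) (insert_ear a T) (insert_ear (Suc a) T)"
proof -
  have aM: "a < M" using a by simp
  have M3: "3 \<le> M + 3" by simp
  note TD = colorfulD(1)[OF M T] and nc = colorfulD(2)[OF M T]
  have noT: "Suc a \<notin> d" if d: "d \<in> T" for d
  proof
    assume "Suc a \<in> d"
    then obtain y where y: "d = {Suc a, y}" "y \<noteq> Suc a"
      using d TD unfolding diagonals_def segments_def by auto
    have "edge M T (Suc a) y" "edge M T y (Suc a)"
      using d y by (auto simp: edge_def insert_commute)
    then have "y = a \<or> y = a + 2"
      using nc[of a "Suc a" "a + 2" y] nc[of y a "Suc a" "a + 2"] e y by force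
    then have "d \<in> sides M"
      using Suc_in_sides[of a M] Suc_in_sides[of "Suc a" M] a y by (auto simp: insert_commute)
    then show False using d TD by (auto simp: diagonals_def)
  qed
  let ?Y = "(`) (shift a) ` T"
  have "shift a ` d = shift (Suc a) ` d" if "d \<in> T" for d
    using noT[OF that] by (intro image_cong) (auto simp: shift_def le_Suc_eq)
  then have Y: "(`) (shift (Suc a)) ` T = ?Y" by auto
  \<comment> \<open>\<open>a + 2\<close> is no value of \<open>shift a\<close>, and
    \<open>a + 4\<close> is the image of the isolated vertex \<open>a + 1\<close>. Each removed
    diagonal contains one of them.\<close>
  have "a + 2 \<notin> d" "a + 4 \<notin> d" if "d \<in> ?Y" for d
    using that noT by (auto simp: shift_def split: if_splits)
  then have disj: "?Y - {{a, a + 2}, {a + 2, a + 4}, {a + 4, a}} = ?Y" by blast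
  have ed: "edge (M + 3) (insert_ear a T) a (a + 2)" "edge (M + 3) (insert_ear a T) (a + 2) (a + 4)"
    "edge (M + 3) (insert_ear a T) a (a + 4)"
    by (auto simp: edge_def insert_ear_def)
  have es: "edge (M + 3) (insert_ear a T) (a + i) (a + Suc i)" if "i < 5" for i
    using edge_Suc[of "a + i" "M + 3" "insert_ear a T"] that a by simp
  \<comment> \<open>The lift of \<open>{a, a + 2}\<close> is \<open>{a, a + 5}\<close>, which closes
    the hexagon.\<close>
  have e5: "edge (M + 3) (insert_ear a T) a (a + 5)"
  proof -
    have "shift a a = a" "shift a (a + 2) = a + 5" by (simp_all add: shift_def)
    then show ?thesis using edge_insert_ear_shift[OF M a(1) aM TD, of a "a + 2"] e by metis
  qed
  have tri: "{x, y, z} \<in> triangles (M + 3) (insert_ear a T)"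
    if "edge (M + 3) (insert_ear a T) x y" "edge (M + 3) (insert_ear a T) y z" "edge (M + 3) (insert_ear a T) x z" for x y z
    using that unfolding triangles_eq[OF M3 insert_ear_subset_diagonals[OF M a(1) aM TD]] by blast
  have "circular_order [a, a + 1, a + 2, a + 3, a + 4, a + 5]"
    unfolding circular_order_def by (intro exI[of _ 0]) simp
  moreover have "{{a, a + 2, a + 4}, {a, a + 1, a + 2}, {a + 2, a + 3, a + 4}, {a + 4, a + 5, a}}
      \<subseteq> triangles (M + 3) (insert_ear a T)"
    using ed e5 es[of 0] es[of 1] es[of 2] es[of 3] es[of 4]
      tri[of a "a + 2" "a + 4"] tri[of a "a + 1" "a + 2"] tri[of "a + 2" "a + 3" "a + 4"]
      tri[of "a + 4" "a + 5" a] edge_commute[of "M + 3" "insert_ear a T" "a + 5" a]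
      edge_commute[of "M + 3" "insert_ear a T" "a + 4" a]
    by (simp add: numeral_eq_Suc)
  moreover have "insert_ear (Suc a) T = (insert_ear a T - {{a, a + 2}, {a + 2, a + 4}, {a + 4, a}}) \<union>
      {{a + 1, a + 3}, {a + 3, a + 5}, {a + 5, a + 1}}"
  proof -
    have "insert_ear a T - {{a, a + 2}, {a + 2, a + 4}, {a + 4, a}} = ?Y"
      unfolding insert_ear_def using disj by (auto simp: insert_commute)
    moreover have "insert_ear (Suc a) T = ?Y \<union> {{a + 1, a + 3}, {a + 3, a + 5}, {a + 5, a + 1}}"
      unfolding insert_ear_def Y by (simp add: insert_commute numeral_eq_Suc)
    ultimately show ?thesis by simp
  qed
  ultimately show ?thesis unfolding twist_def by blast
qed

section \<open>The triangle and a supply of colorful triangulations\<close>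

lemma colorful_triangulations_3: "colorful_triangulations 3 = {{}}"
proof -
  have D: "d \<notin> diagonals 3" for d
  proof
    assume d: "d \<in> diagonals 3"
    then obtain x y where "d = {x, y}" "x < y" "1 \<le> x" "y \<le> 3"
      using segments_cases unfolding diagonals_def by blast
    then show False using d by (auto simp: diagonals_iff)
  qed
  have S: "{x, y} \<in> sides 3 \<longleftrightarrow> x \<in> {1, 2, 3} \<and> y \<in> {1, 2, 3} \<and> x \<noteq> y" for x y
    by (auto simp: sides_def doubleton_eq_iff numeral_eq_Suc less_Suc_eq)
  have "{} \<in> colorful_triangulations 3"
    unfolding colorful_iff[OF order_refl] triangulation_iff[OF order_refl] edge_def
    by (auto simp: S)
  moreover have "T = {}" if "T \<in> colorful_triangulations 3" for T
    using colorfulD(1)[OF order_refl that] D by blast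
  ultimately show ?thesis by blast
qed

lemma colorful_triangulations_nonempty: "\<exists>T. T \<in> colorful_triangulations (3 * Suc n)"
proof (induction n)
  case 0
  then show ?case using colorful_triangulations_3 by simp
next
  case (Suc n)
  then obtain T where "T \<in> colorful_triangulations (3 * Suc n)" by blast
  then have "insert_ear 1 T \<in> colorful_triangulations (3 * Suc n + 3)" by (intro insert_ear_colorful) auto
  then show ?case by (auto simp: algebra_simps)
qed

text \<open>This supplies the triangulation at which the ear can be moved from \<open>a\<close> to
  \<open>a + 1\<close>.\<close>

lemma exists_colorful_with_edge:
  assumes M: "M = 3 * Suc n" and a: "1 \<le> a" "a + 2 \<le> M"
  obtains T where "T \<in> colorful_triangulations M" "edge M T a (a + 2)"
proof (cases n)
  case 0
  then have "M = 3" "a = 1" using M a by auto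
  then show thesis
    using that[of "{}"] colorful_triangulations_3 edge_first_last[of 3 "{}"] by (simp add: numeral_eq_Suc)
next
  case (Suc m)
  define K where "K = 3 * Suc m"
  have K: "M = K + 3" "3 \<le> K" using M Suc by (auto simp: K_def)
  obtain T where T: "T \<in> colorful_triangulations K"
    using colorful_triangulations_nonempty unfolding K_def by blast
  \<comment> \<open>An ear can only be inserted at \<open>b < K\<close>. For the last positions
    \<open>K\<close> and \<open>K + 1\<close> of \<open>a\<close>, the second short diagonal
    \<open>{b + 2, b + 4}\<close> of an ear is used in place of the first.\<close>
  define b where "b = (if a < K then a else a - 2)"
  have b: "1 \<le> b" "b < K" "a = b \<or> a = b + 2" using a K by (auto simp: b_def)
  have "edge M (insert_ear b T) a (a + 2)"
    using b(3) by (auto simp: edge_def insert_ear_def numeral_eq_Suc)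
  then show thesis using that insert_ear_colorful[OF K(2) b(1,2) T] K by blast
qed

section \<open>Connectedness by induction on the number of vertices\<close>

lemma parcs_twist_graph_iff:
  "(T, T') \<in> parcs (twist_graph N) \<longleftrightarrow> T \<in> colorful_triangulations N \<and>
    T' \<in> colorful_triangulations N \<and> (twist N T T' \<or> twist N T' T)"
  by (simp add: twist_graph_def)

lemma sym_parcs_twist_graph: "sym (parcs (twist_graph N))"
  by (auto simp: sym_def parcs_twist_graph_iff)

lemma insert_ear_reachable:
  assumes M: "3 \<le> M" and a: "1 \<le> a" "a < M" and r: "(T, T') \<in> (parcs (twist_graph M))\<^sup>*"
  shows "(insert_ear a T, insert_ear a T') \<in> (parcs (twist_graph (M + 3)))\<^sup>*"
  using r
proof (induction rule: rtrancl_induct)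
  case (step T' T'')
  then have "(insert_ear a T', insert_ear a T'') \<in> parcs (twist_graph (M + 3))"
    using twist_insert_ear[OF M a] insert_ear_colorful[OF M a] colorfulD(1)[OF M]
    unfolding parcs_twist_graph_iff by blast
  with step.IH show ?case by (rule rtrancl_into_rtrancl)
qed simp

lemma twist_reachable:
  assumes "T \<in> colorful_triangulations (3 * Suc n)" "T' \<in> colorful_triangulations (3 * Suc n)"
  shows "(T, T') \<in> (parcs (twist_graph (3 * Suc n)))\<^sup>*"
  using assms
proof (induction n arbitrary: T T')
  case 0
  then show ?case using colorful_triangulations_3 by simp
next
  case (Suc n)
  define M where "M = 3 * Suc n"
  have M: "3 \<le> M" and N: "3 * Suc (Suc n) = M + 3" by (simp_all add: M_def)
  let ?R = "parcs (twist_graph (M + 3))"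
  \<comment> \<open>The induction hypothesis connects \<open>S\<close> with \<open>S'\<close>, and
    the path lifts through the insertion at \<open>a\<close>.\<close>
  have same: "(insert_ear a S, insert_ear a S') \<in> ?R\<^sup>*"
    if "1 \<le> a" "a < M" "S \<in> colorful_triangulations M" "S' \<in> colorful_triangulations M" for a S S'
    using insert_ear_reachable[OF M that(1,2)] Suc.IH that(3,4) unfolding M_def by blast
  have from_1: "(insert_ear 1 S, insert_ear a S') \<in> ?R\<^sup>*"
    if "1 \<le> a" "a < M" "S \<in> colorful_triangulations M" "S' \<in> colorful_triangulations M" for a S S'
    using that
  proof (induction a arbitrary: S' rule: dec_induct)
    case base
    then show ?case using same by blast
  next
    case (step a)
    have a: "1 \<le> a" "a < M" "a + 2 \<le> M" using step by simp_all
    \<comment> \<open>\<open>U\<close> is the bridge: change the smaller triangulation to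
      \<open>U\<close> keeping the ear at \<open>a\<close>, twist, then change \<open>U\<close> to
      \<open>S'\<close> keeping the ear at \<open>Suc a\<close>.\<close>
    obtain U where U: "U \<in> colorful_triangulations M" "edge M U a (a + 2)"
      using exists_colorful_with_edge[OF M_def a(1,3)] by blast
    have "(insert_ear 1 S, insert_ear a U) \<in> ?R\<^sup>*" using step a U by blast
    also have "(insert_ear a U, insert_ear (Suc a) U) \<in> ?R"
      using twist_insert_ear_Suc[OF M a(1,3) U] insert_ear_colorful[OF M _ _ U(1)] step a
      unfolding parcs_twist_graph_iff by simp
    also have "(insert_ear (Suc a) U, insert_ear (Suc a) S') \<in> ?R\<^sup>*"
      using same[of "Suc a" U S'] step U by simp
    finally show ?case .
  qed
  have ex: "\<exists>a S. 1 \<le> a \<and> a < M \<and> S \<in> colorful_triangulations M \<and> V = insert_ear a S"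
    if V: "V \<in> colorful_triangulations (M + 3)" for V
  proof -
    have "6 \<le> M + 3" "3 dvd M + 3" by (simp_all add: M_def)
    then obtain a where a: "1 \<le> a" "a + 4 \<le> M + 3" "{{a, a + 2}, {a + 2, a + 4}, {a, a + 4}} \<subseteq> V"
      using colorful_has_ear V by blast
    then have "a < M" by simp
    then show ?thesis using colorful_eq_insert_ear[OF M a(1) _ V a(3)] a(1) by metis
  qed
  obtain a S where S: "1 \<le> a" "a < M" "S \<in> colorful_triangulations M" "T = insert_ear a S"
    using ex Suc.prems(1) unfolding N by blast
  obtain b S' where S': "1 \<le> b" "b < M" "S' \<in> colorful_triangulations M" "T' = insert_ear b S'"
    using ex Suc.prems(2) unfolding N by blast
  have "(insert_ear 1 S, T) \<in> ?R\<^sup>*" "(insert_ear 1 S, T') \<in> ?R\<^sup>*"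
    using from_1 S S' by blast+
  then show ?case
    unfolding N using sym_rtrancl[OF sym_parcs_twist_graph, of "M + 3"]
    by (meson rtrancl_trans symD)
qed

theorem theorem9:
  fixes N :: nat
  assumes "3 dvd N"
  shows "connected (with_proj (twist_graph N))"
proof -
  let ?C = "colorful_triangulations N" and ?R = "parcs (twist_graph N)"
  obtain k where k: "N = 3 * k" using assms by blast
  have C: "?C \<noteq> {} \<and> (\<forall>T\<in>?C. \<forall>T'\<in>?C. (T, T') \<in> ?R\<^sup>*)"
  proof (cases k)
    case 0
    \<comment> \<open>For \<open>N = 0\<close> there are no vertices, so the empty set is the only
      triangulation and the color condition is vacuous.\<close>
    have "?C = {{}}"
      using k 0 by (auto simp: colorful_triangulations_def triangulation_def diagonals_def
          segments_def triangles_def)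
    then show ?thesis by simp
  next
    case (Suc n)
    then show ?thesis
      using k twist_reachable[of _ n] colorful_triangulations_nonempty[of n] by blast
  qed
  \<comment> \<open>\<open>connected\<close> means strong connectedness of the symmetric closure,
    with reachability confined to vertices of the graph, so each path in \<open>?R\<close> is
    transferred there step by step.\<close>
  have "T \<rightarrow>\<^sup>*\<^bsub>with_proj (mk_symmetric (with_proj (twist_graph N)))\<^esub> T'"
    if "(T, T') \<in> ?R\<^sup>*" "T \<in> ?C" for T T'
    using that(1)
  proof (induction rule: rtrancl_induct)
    case base
    then show ?case using that(2) by (simp add: reachable_def twist_graph_def)
  next
    case (step U V)
    have "(U, V) \<in> parcs (mk_symmetric (with_proj (twist_graph N)))"
      using step.hyps(2) by (force simp: parcs_mk_symmetric)
    moreover have "V \<in> ?C" using step.hyps(2) by (simp add: parcs_twist_graph_iff)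
    ultimately show ?case
      using step.IH unfolding reachable_def
      by (auto intro: rtrancl_on_into_rtrancl_on simp: twist_graph_def)
  qed
  then show ?thesis
    using C unfolding connected_def strongly_connected_def by (simp add: twist_graph_def)
qed

end
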